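(* A real symmetric matrix $A$ has symmetric Kapranov rank two if and only if it has symmetric tropical rank two. (Equivalently, for every $n\ge 3$, the $3\times 3$ minors of an $n\times n$ symmetric matrix of indeterminates form a tropical basis.)
   Context: Let $\tilde K$ be the field of Hahn series $\sum_{\alpha\in A}c_\alpha t^\alpha$ ($A\subset\mathbb R$ well-ordered, $c_\alpha\in\mathbb C$); for nonzero $a\in\tilde K$, $\deg(a)$ is the smallest exponent with nonzero coefficient. A symmetric lift of a real symmetric matrix $A$ is a symmetric matrix $\tilde A$ over $\tilde K$ with all entries nonzero and $\deg(\tilde a_{i,j})=A_{i,j}$; the symmetric Kapranov rank of $A$ is the minimum rank of a symmetric lift. For an $r\times r$ submatrix of $A$ with row index set $I$ and column index set $J$, each bijection $\rho:I\to J$ gives a monomial $\prod_{i\in I}X_{i,\rho(i)}$ in commuting variables subject to $X_{i,j}=X_{j,i}$, with value $\sum_{i\in I}A_{i,\rho(i)}$; the submatrix is symmetrically tropically singular if the minimum value is attained by at least two distinct monomials. The symmetric tropical rank of $A$ is the largest $r$ such that $A$ has an $r\times r$ submatrix that is not symmetrically tropically singular. The $r\times r$ minors form a tropical basis if for every real symmetric $n\times n$ $A$: all $r\times r$ submatrices are symmetrically tropically singular iff $A$ has a symmetric lift of rank $\le r-1$. *)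

theory Defs
  imports Complex_Main "HOL-Combinatorics.Permutations" "HOL-Library.Multiset" "HOL-Library.FuncSet"
begin

text \<open>A Hahn series sum c_a t^a is represented by its coefficient function real => complex;
  it is a Hahn series iff its support is well-ordered.\<close>

definition hahn :: "(real \<Rightarrow> complex) \<Rightarrow> bool" where
  "hahn f \<longleftrightarrow> (\<forall>S. S \<subseteq> {x. f x \<noteq> 0} \<longrightarrow> S \<noteq> {} \<longrightarrow> (\<exists>m\<in>S. \<forall>x\<in>S. m \<le> x))"

definition hdeg :: "(real \<Rightarrow> complex) \<Rightarrow> real" where
  "hdeg f = (LEAST x. f x \<noteq> 0)"

text \<open>Coefficient at exponent g of the product F 0 * ... * F (k-1) of Hahn series
  (Cauchy product; the index set is finite for Hahn series).\<close>

definition hprod_coeff :: "nat \<Rightarrow> (nat \<Rightarrow> real \<Rightarrow> complex) \<Rightarrow> real \<Rightarrow> complex" where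
  "hprod_coeff k F g =
     (\<Sum>a \<in> {a \<in> PiE {..<k} (\<lambda>i. {x. F i x \<noteq> 0}). (\<Sum>i<k. a i) = g}. \<Prod>i<k. F i (a i))"

definition minor_coeff ::
  "(nat \<Rightarrow> nat \<Rightarrow> real \<Rightarrow> complex) \<Rightarrow> nat \<Rightarrow> (nat \<Rightarrow> nat) \<Rightarrow> (nat \<Rightarrow> nat) \<Rightarrow> real \<Rightarrow> complex" where
  "minor_coeff M k r c g =
     (\<Sum>p | p permutes {..<k}. of_int (sign p) * hprod_coeff k (\<lambda>i. M (r i) (c (p i))) g)"

definition hrank :: "nat \<Rightarrow> (nat \<Rightarrow> nat \<Rightarrow> real \<Rightarrow> complex) \<Rightarrow> nat" where
  "hrank n M = (GREATEST k. \<exists>r c. strict_mono_on {..<k} r \<and> strict_mono_on {..<k} c \<and>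
       (\<forall>i<k. r i < n \<and> c i < n) \<and> (\<exists>g. minor_coeff M k r c g \<noteq> 0))"

definition sym_lift :: "nat \<Rightarrow> (nat \<Rightarrow> nat \<Rightarrow> real) \<Rightarrow> (nat \<Rightarrow> nat \<Rightarrow> real \<Rightarrow> complex) \<Rightarrow> bool" where
  "sym_lift n A L \<longleftrightarrow> (\<forall>i<n. \<forall>j<n. hahn (L i j) \<and> L i j \<noteq> (\<lambda>_. 0) \<and>
       hdeg (L i j) = A i j \<and> L i j = L j i)"

definition sym_kapranov_rank :: "nat \<Rightarrow> (nat \<Rightarrow> nat \<Rightarrow> real) \<Rightarrow> nat" where
  "sym_kapranov_rank n A = (LEAST k. \<exists>L. sym_lift n A L \<and> hrank n L = k)"

text \<open>The monomial prod_{i in I} X_{i, rho i} in commuting variables with X_{i,j} = X_{j,i},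
  represented as the multiset of unordered index pairs {i, rho i}.\<close>

definition sym_monomial :: "nat set \<Rightarrow> (nat \<Rightarrow> nat) \<Rightarrow> nat set multiset" where
  "sym_monomial I \<rho> = image_mset (\<lambda>i. {i, \<rho> i}) (mset_set I)"

definition trop_value :: "(nat \<Rightarrow> nat \<Rightarrow> real) \<Rightarrow> nat set \<Rightarrow> (nat \<Rightarrow> nat) \<Rightarrow> real" where
  "trop_value A I \<rho> = (\<Sum>i\<in>I. A i (\<rho> i))"

definition sym_trop_singular :: "(nat \<Rightarrow> nat \<Rightarrow> real) \<Rightarrow> nat set \<Rightarrow> nat set \<Rightarrow> bool" where
  "sym_trop_singular A I J \<longleftrightarrow>
     (\<exists>\<rho>1 \<rho>2. bij_betw \<rho>1 I J \<and> bij_betw \<rho>2 I J \<and>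
        sym_monomial I \<rho>1 \<noteq> sym_monomial I \<rho>2 \<and>
        trop_value A I \<rho>1 = trop_value A I \<rho>2 \<and>
        (\<forall>\<rho>. bij_betw \<rho> I J \<longrightarrow> trop_value A I \<rho>1 \<le> trop_value A I \<rho>))"

definition sym_tropical_rank :: "nat \<Rightarrow> (nat \<Rightarrow> nat \<Rightarrow> real) \<Rightarrow> nat" where
  "sym_tropical_rank n A = (GREATEST k. \<exists>I J. I \<subseteq> {..<n} \<and> J \<subseteq> {..<n} \<and>
       card I = k \<and> card J = k \<and> \<not> sym_trop_singular A I J)"

end

theory Submission
  imports Defs "HOL-Library.Poly_Mapping" "HOL-Library.Infinite_Set"
begin

text \<open>
  If a lift has vanishing \<open>k \<times> k\<close> minors with \<open>k \<le> 3\<close>, the lowest coefficient of each minor must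
  cancel; permutations with the same symmetric monomial have the same sign, so at least two
  monomials attain the minimum. Larger submatrices reduce to these, because deleting from a
  nonsingular submatrix a row and the column matched to it leaves a nonsingular one.

  Conversely, symmetric matrices \<open>s i * s j * (p i + p j)\<close> have rank at most two. Normalise the
  diagonal of the tropical matrix to \<open>0\<close>. Singularity of the \<open>3 \<times> 3\<close> submatrices forces the negative
  entries to be \<open>-\<bar>v i - v j\<bar>\<close> for points \<open>v i\<close> of the line, and forces the entries exceeding
  any level \<open>r \<ge> 0\<close> to form a disjoint union of complete bipartite graphs. Take \<open>p i\<close> of valuation
  \<open>2 * v i\<close> whose coefficient at relative exponent \<open>r\<close> is a label of the component of \<open>i\<close> at level \<open>r\<close>,
  with opposite signs on the two sides of a bipartite component: then \<open>p i + p j\<close> cancels exactly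
  below the prescribed entry.
\<close>

section \<open>Ranks and singular submatrices\<close>

lemma Greatest_less_iff:
  fixes P :: "nat \<Rightarrow> bool"
  assumes "P 0" "\<And>k. P k \<Longrightarrow> k \<le> b" "0 < m"
  shows "(GREATEST k. P k) < m \<longleftrightarrow> (\<forall>k\<ge>m. \<not> P k)"
proof
  assume less: "(GREATEST k. P k) < m"
  show "\<forall>k\<ge>m. \<not> P k"
  proof (intro allI impI notI)
    fix k assume "m \<le> k" "P k"
    then show False using Greatest_le_nat[of P k b] assms(2) less by force
  qed
next
  assume "\<forall>k\<ge>m. \<not> P k"
  moreover have "P (GREATEST k. P k)"
    using GreatestI_nat[of P 0 b] assms by blast
  ultimately show "(GREATEST k. P k) < m" by (meson not_le)
qed

lemma hrank_less_iff:
  assumes "0 < m"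
  shows "hrank n M < m \<longleftrightarrow> (\<forall>k\<ge>m. \<forall>r c. strict_mono_on {..<k} r \<longrightarrow> strict_mono_on {..<k} c \<longrightarrow>
     (\<forall>i<k. r i < n \<and> c i < n) \<longrightarrow> (\<forall>g. minor_coeff M k r c g = 0))"
proof -
  define P where "P = (\<lambda>k. \<exists>r c. strict_mono_on {..<k} r \<and> strict_mono_on {..<k} c \<and>
       (\<forall>i<k. r i < n \<and> c i < n) \<and> (\<exists>g. minor_coeff M k r c g \<noteq> 0))"
  \<comment> \<open>The empty minor is the series 1, so its coefficient at exponent 0 is nonzero and
    \<open>GREATEST\<close> ranges over a nonempty set.\<close>
  have "{a. (a::nat\<Rightarrow>real) = (\<lambda>x. undefined)} = {\<lambda>x. undefined}" by auto
  then have "minor_coeff M 0 id id 0 \<noteq> 0"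
    by (simp add: minor_coeff_def hprod_coeff_def)
  then have P0: "P 0" unfolding P_def
    by (intro exI[of _ id] conjI exI[of _ "0::real"]) (auto simp: strict_mono_on_def)
  have bound: "k \<le> n" if "P k" for k
  proof -
    from that obtain r where r: "strict_mono_on {..<k} r" "\<forall>i<k. r i < (n::nat)"
      unfolding P_def by blast
    have "inj_on r {..<k}" using r(1) by (rule strict_mono_on_imp_inj_on)
    moreover have "r ` {..<k} \<subseteq> {..<n}" using r(2) by auto
    ultimately show ?thesis using card_inj_on_le[of r "{..<k}" "{..<n}"] by simp
  qed
  have "hrank n M = (GREATEST k. P k)" by (simp add: hrank_def P_def)
  then have "hrank n M < m \<longleftrightarrow> (\<forall>k\<ge>m. \<not> P k)"
    using Greatest_less_iff[of P n m, OF P0 bound assms] by simp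
  then show ?thesis unfolding P_def by blast
qed

section \<open>Minimal matchings and deletion of a matched pair\<close>

lemma ex_minimal_bij_betw:
  assumes "finite I" "card I = card J" "finite J"
  obtains \<rho> where "bij_betw \<rho> I J"
    "\<And>\<sigma>. bij_betw \<sigma> I J \<Longrightarrow> trop_value A I \<rho> \<le> trop_value A I \<sigma>"
proof -
  define V where "V = trop_value A I ` {\<rho>. bij_betw \<rho> I J}"
  \<comment> \<open>Matchings are total functions, arbitrary outside \<open>I\<close>, so there are
    infinitely many of them; their values depend only on the restriction to
    \<open>I\<close>.\<close>
  have "V \<subseteq> trop_value A I ` (I \<rightarrow>\<^sub>E J)"
  proof
    fix v assume "v \<in> V"
    then obtain \<rho> where \<rho>: "bij_betw \<rho> I J" "v = trop_value A I \<rho>" by (auto simp: V_def)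
    have "restrict \<rho> I \<in> I \<rightarrow>\<^sub>E J" using \<rho>(1) by (auto simp: bij_betw_def)
    moreover have "v = trop_value A I (restrict \<rho> I)" using \<rho>(2) by (simp add: trop_value_def)
    ultimately show "v \<in> trop_value A I ` (I \<rightarrow>\<^sub>E J)" by blast
  qed
  then have fin: "finite V" by (rule finite_subset) (simp add: assms finite_PiE)
  have "\<exists>\<rho>. bij_betw \<rho> I J" using assms finite_same_card_bij by blast
  then have "V \<noteq> {}" by (auto simp: V_def)
  then have "Min V \<in> V" using fin by simp
  then obtain \<rho> where "bij_betw \<rho> I J" "Min V = trop_value A I \<rho>" by (auto simp: V_def)
  moreover have "Min V \<le> trop_value A I \<sigma>" if "bij_betw \<sigma> I J" for \<sigma>
    using that fin by (intro Min_le) (auto simp: V_def)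
  ultimately show ?thesis using that by metis
qed

text \<open>Delete a row \<open>i\<close> and its partner \<open>\<rho> i\<close> in a minimal
  matching \<open>\<rho>\<close>. Two distinct minimal monomials of the rest would, after
  multiplication by the common factor for \<open>{i, \<rho> i}\<close>, be two distinct minimal
  monomials of the whole.\<close>

lemma nonsingular_delete:
  assumes "card I = Suc k" "card J = Suc k" "\<not> sym_trop_singular A I J"
  obtains i j where "i \<in> I" "j \<in> J" "\<not> sym_trop_singular A (I - {i}) (J - {j})"
proof -
  have fin: "finite I" "finite J" using assms card.infinite by fastforce+
  obtain \<rho> where \<rho>: "bij_betw \<rho> I J"
    and min: "\<And>\<sigma>. bij_betw \<sigma> I J \<Longrightarrow> trop_value A I \<rho> \<le> trop_value A I \<sigma>"
    using ex_minimal_bij_betw fin assms by metis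
  obtain i where i: "i \<in> I" using assms(1) by fastforce
  define j where "j = \<rho> i"
  have j: "j \<in> J" using \<rho> i by (auto simp: j_def bij_betw_def)
  have val: "trop_value A I \<sigma> = A i (\<sigma> i) + trop_value A (I - {i}) \<sigma>" for \<sigma>
    using i fin by (simp add: trop_value_def sum.remove)
  have mon: "sym_monomial I \<sigma> = add_mset {i, \<sigma> i} (sym_monomial (I - {i}) \<sigma>)" for \<sigma>
    using i fin by (simp add: sym_monomial_def mset_set.remove)
  have upd: "trop_value A (I - {i}) (\<sigma>(i := j)) = trop_value A (I - {i}) \<sigma>"
    "sym_monomial (I - {i}) (\<sigma>(i := j)) = sym_monomial (I - {i}) \<sigma>" for \<sigma>
    using fin unfolding trop_value_def sym_monomial_def
    by (auto intro!: sum.cong image_mset_cong)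
  have bij: "bij_betw (\<sigma>(i := j)) I J" if "bij_betw \<sigma> (I - {i}) (J - {j})" for \<sigma>
  proof -
    have "bij_betw (\<sigma>(i := j)) (I - {i}) (J - {j})"
      using that by (rule bij_betw_cong[THEN iffD1, rotated]) auto
    then have "bij_betw (\<sigma>(i := j)) (insert i (I - {i})) (insert j (J - {j}))"
      using notIn_Un_bij_betw[of i "I - {i}" "\<sigma>(i := j)" "J - {j}"] by simp
    then show ?thesis using i j by (simp add: insert_absorb)
  qed
  have \<rho>': "bij_betw \<rho> (I - {i}) (J - {j})"
    using \<rho> i unfolding j_def by (intro bij_betw_DiffI) (auto simp: bij_betw_def)
  have "\<not> sym_trop_singular A (I - {i}) (J - {j})"
  proof
    assume "sym_trop_singular A (I - {i}) (J - {j})"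
    then obtain \<sigma> \<tau> where st: "bij_betw \<sigma> (I - {i}) (J - {j})" "bij_betw \<tau> (I - {i}) (J - {j})"
        "sym_monomial (I - {i}) \<sigma> \<noteq> sym_monomial (I - {i}) \<tau>"
        "trop_value A (I - {i}) \<sigma> = trop_value A (I - {i}) \<tau>"
        "\<And>\<pi>. bij_betw \<pi> (I - {i}) (J - {j}) \<Longrightarrow> trop_value A (I - {i}) \<sigma> \<le> trop_value A (I - {i}) \<pi>"
      unfolding sym_trop_singular_def by blast
    \<comment> \<open>\<open>\<rho>\<close> restricts to the smaller submatrix, so it bounds the
      extension of \<open>\<sigma>\<close>, which is therefore minimal as well.\<close>
    have "trop_value A I (\<sigma>(i := j)) \<le> trop_value A I \<rho>"
      using st(5)[OF \<rho>'] upd(1)[of \<sigma>] val[of \<rho>] val[of "\<sigma>(i := j)"] by (simp add: j_def)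
    then have "trop_value A I (\<sigma>(i := j)) \<le> trop_value A I \<pi>" if "bij_betw \<pi> I J" for \<pi>
      using min[OF that] by linarith
    moreover have "trop_value A I (\<sigma>(i := j)) = trop_value A I (\<tau>(i := j))"
      using val[of "\<sigma>(i := j)"] val[of "\<tau>(i := j)"] upd(1) st(4) by simp
    moreover have "sym_monomial I (\<sigma>(i := j)) \<noteq> sym_monomial I (\<tau>(i := j))"
      using mon[of "\<sigma>(i := j)"] mon[of "\<tau>(i := j)"] upd(2) st(3) by simp
    ultimately have "sym_trop_singular A I J"
      unfolding sym_trop_singular_def using bij st(1,2) by blast
    then show False using assms(3) by simp
  qed
  then show ?thesis using that i j by blast
qed

lemma nonsingular_submatrix:
  assumes "card I = k" "card J = k" "\<not> sym_trop_singular A I J" "m \<le> k"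
  shows "\<exists>I'\<subseteq>I. \<exists>J'\<subseteq>J. card I' = m \<and> card J' = m \<and> \<not> sym_trop_singular A I' J'"
  using assms
proof (induction k arbitrary: I J)
  case 0
  then show ?case by auto
next
  case (Suc k)
  show ?case
  proof (cases "m = Suc k")
    case True
    then show ?thesis using Suc.prems by auto
  next
    case False
    obtain i j where ij: "i \<in> I" "j \<in> J" "\<not> sym_trop_singular A (I - {i}) (J - {j})"
      using nonsingular_delete Suc.prems by metis
    have "\<exists>I'\<subseteq>I - {i}. \<exists>J'\<subseteq>J - {j}. card I' = m \<and> card J' = m \<and> \<not> sym_trop_singular A I' J'"
      using ij Suc.prems False by (intro Suc.IH) auto
    then show ?thesis by blast
  qed
qed

text \<open>Only size \<open>m\<close> has to be tested, since a larger nonsingular submatrix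
  contains a nonsingular one of that size.\<close>

lemma sym_tropical_rank_less_iff:
  assumes "0 < m"
  shows "sym_tropical_rank n A < m \<longleftrightarrow> (\<forall>I J. I \<subseteq> {..<n} \<longrightarrow> J \<subseteq> {..<n} \<longrightarrow>
    card I = m \<longrightarrow> card J = m \<longrightarrow> sym_trop_singular A I J)" (is "_ \<longleftrightarrow> ?R")
proof -
  define P where "P = (\<lambda>k. \<exists>I J. I \<subseteq> {..<n} \<and> J \<subseteq> {..<n} \<and>
       card I = k \<and> card J = k \<and> \<not> sym_trop_singular A I J)"
  have P0: "P 0" unfolding P_def
    by (intro exI[of _ "{}"]) (simp add: sym_trop_singular_def sym_monomial_def)
  have bound: "k \<le> n" if "P k" for k
    using that card_mono[of "{..<n}"] by (force simp: P_def)
  have "sym_tropical_rank n A = (GREATEST k. P k)" by (simp add: sym_tropical_rank_def P_def)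
  then have "sym_tropical_rank n A < m \<longleftrightarrow> (\<forall>k\<ge>m. \<not> P k)"
    using Greatest_less_iff[of P n m, OF P0 bound assms] by simp
  also have "\<dots> \<longleftrightarrow> \<not> P m"
  proof -
    have "P m" if Pk: "P k" and "m \<le> k" for k
    proof -
      from Pk obtain I J where IJ: "I \<subseteq> {..<n}" "J \<subseteq> {..<n}" "card I = k" "card J = k"
        "\<not> sym_trop_singular A I J" unfolding P_def by blast
      obtain I' J' where "I' \<subseteq> I" "J' \<subseteq> J" "card I' = m" "card J' = m" "\<not> sym_trop_singular A I' J'"
        using nonsingular_submatrix[OF IJ(3-5) \<open>m \<le> k\<close>] by blast
      then show ?thesis using IJ(1,2) unfolding P_def
        by (intro exI[of _ I'] exI[of _ J']) auto
    qed
    then show ?thesis by blast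
  qed
  also have "\<dots> \<longleftrightarrow> ?R" unfolding P_def by auto
  finally show ?thesis .
qed

text \<open>A matching uses each row of \<open>I\<close> and each column of \<open>J\<close> exactly
  once, so every value grows by \<open>sum a I + sum a J\<close>.\<close>

lemma sym_trop_singular_shift:
  "sym_trop_singular (\<lambda>i j. A i j + a i + a j) I J \<longleftrightarrow> sym_trop_singular A I J"
proof -
  have "trop_value (\<lambda>i j. A i j + a i + a j) I \<rho> = trop_value A I \<rho> + sum a I + sum a J"
    if "bij_betw \<rho> I J" for \<rho>
    using sum.reindex_bij_betw[OF that, of a] by (simp add: trop_value_def sum.distrib)
  then show ?thesis unfolding sym_trop_singular_def
    by (intro arg_cong[where f = Ex] ext) (auto cong: conj_cong)
qed

section \<open>Minors of Hahn series matrices\<close>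

lemma poly_mapping_eq_sum_single:
  "p = (\<Sum>a\<in>Poly_Mapping.keys p. Poly_Mapping.single a (Poly_Mapping.lookup p a))"
  by (rule poly_mapping_eqI)
    (auto simp: lookup_sum lookup_single when_def in_keys_iff sum.delta)

lemma prod_single:
  "finite S \<Longrightarrow> (\<Prod>i\<in>S. Poly_Mapping.single (a i) (c i)) = Poly_Mapping.single (\<Sum>i\<in>S. a i) (\<Prod>i\<in>S. c i)"
  for a :: "'i \<Rightarrow> 'a::comm_monoid_add" and c :: "'i \<Rightarrow> 'b::comm_semiring_1"
  by (induction S rule: finite_induct) (auto simp: mult_single)

text \<open>For finitely supported series the Cauchy product is multiplication of
  \<open>poly_mapping\<close>s, so minors of the constructed lifts can be computed in a commutative
  ring.\<close>

lemma lookup_prod_eq_hprod_coeff: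
  fixes F :: "nat \<Rightarrow> real \<Rightarrow>\<^sub>0 complex"
  shows "Poly_Mapping.lookup (\<Prod>i<k. F i) g = hprod_coeff k (\<lambda>i. Poly_Mapping.lookup (F i)) g"
proof -
  let ?K = "PiE {..<k} (\<lambda>i. Poly_Mapping.keys (F i))"
  have "(\<Prod>i<k. F i) =
      (\<Prod>i<k. \<Sum>a\<in>Poly_Mapping.keys (F i). Poly_Mapping.single a (Poly_Mapping.lookup (F i) a))"
    by (intro prod.cong refl poly_mapping_eq_sum_single)
  also have "\<dots> = (\<Sum>a\<in>?K. \<Prod>i<k. Poly_Mapping.single (a i) (Poly_Mapping.lookup (F i) (a i)))"
    by (rule prod_sum_PiE) auto
  also have "\<dots> = (\<Sum>a\<in>?K. Poly_Mapping.single (\<Sum>i<k. a i) (\<Prod>i<k. Poly_Mapping.lookup (F i) (a i)))"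
    by (simp add: prod_single)
  finally have "Poly_Mapping.lookup (\<Prod>i<k. F i) g =
      (\<Sum>a\<in>?K. if (\<Sum>i<k. a i) = g then \<Prod>i<k. Poly_Mapping.lookup (F i) (a i) else 0)"
    by (simp add: lookup_sum lookup_single when_def)
  also have "\<dots> = (\<Sum>a\<in>{a\<in>?K. (\<Sum>i<k. a i) = g}. \<Prod>i<k. Poly_Mapping.lookup (F i) (a i))"
    by (rule sum.inter_filter[symmetric]) (simp add: finite_PiE)
  also have "?K = PiE {..<k} (\<lambda>i. {x. Poly_Mapping.lookup (F i) x \<noteq> 0})"
    by (intro PiE_cong) (auto simp: in_keys_iff)
  finally show ?thesis by (simp add: hprod_coeff_def)
qed

text \<open>Reindexing by the transposition flips every sign and keeps \<open>f\<close>, so the sum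
  equals its own negative.\<close>

lemma sum_sign_eq_0:
  fixes f :: "(nat \<Rightarrow> nat) \<Rightarrow> complex"
  assumes "finite S" "a \<in> S" "b \<in> S" "a \<noteq> b"
    and inv: "\<And>p. p permutes S \<Longrightarrow> f (p \<circ> transpose a b) = f p"
  shows "(\<Sum>p | p permutes S. of_int (sign p) * f p) = 0"
proof -
  let ?t = "transpose a b"
  have t: "?t permutes S" using assms by (intro permutes_swap_id)
  have "(\<Sum>p | p permutes S. of_int (sign p) * f p) =
      (\<Sum>p | p permutes S. of_int (sign (p \<circ> ?t)) * f (p \<circ> ?t))"
    using sum_permutations_compose_right[OF t, of "\<lambda>p. of_int (sign p) * f p"] by simp
  also have "\<dots> = (\<Sum>p | p permutes S. - (of_int (sign p) * f p))"
  proof (rule sum.cong)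
    fix p assume "p \<in> {p. p permutes S}"
    then have p: "p permutes S" by simp
    have "sign (p \<circ> ?t) = - sign p"
      using sign_compose[of p ?t] p t \<open>finite S\<close> \<open>a \<noteq> b\<close>
      by (simp add: permutes_imp_permutation permutation_swap_id sign_swap_id)
    then show "of_int (sign (p \<circ> ?t)) * f (p \<circ> ?t) = - (of_int (sign p) * f p)"
      using inv[OF p] by simp
  qed simp
  finally show ?thesis by (simp add: sum_negf)
qed

lemma ex_distinct_in_set:
  assumes "2 \<le> card S"
  obtains a b where "a \<in> S" "b \<in> S" "a \<noteq> b"
proof -
  have "finite S" using assms card.infinite by fastforce
  then have "\<not> (\<forall>a\<in>S. \<forall>b\<in>S. a = b)" using assms card_le_Suc0_iff_eq[of S] by auto
  then show ?thesis using that by blast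
qed

lemma prod_compose_transpose:
  assumes "a \<in> S \<and> b \<in> S \<or> a \<notin> S \<and> b \<notin> S"
  shows "(\<Prod>i\<in>S. f (transpose a b i)) = prod f S"
proof (cases "a \<in> S")
  case True
  then have "transpose a b permutes S" using assms by (intro permutes_swap_id) auto
  then show ?thesis using prod.permute[of "transpose a b" S f] by (simp add: comp_def)
next
  case False
  then show ?thesis using assms by (intro prod.cong) (auto simp: transpose_def)
qed

lemma minor_coeff_rank_one:
  fixes x y :: "nat \<Rightarrow> real \<Rightarrow>\<^sub>0 complex"
  assumes "2 \<le> k"
  shows "minor_coeff (\<lambda>i j. Poly_Mapping.lookup (x i * y j)) k r c g = 0"
proof -
  have "2 \<le> card {..<k}" using assms by simp
  then obtain a b where ab: "a < k" "b < k" "a \<noteq> b" using ex_distinct_in_set[of "{..<k}"] by auto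
  have "(\<Sum>p | p permutes {..<k}. of_int (sign p) *
      Poly_Mapping.lookup (\<Prod>i<k. x (r i) * y (c (p i))) g) = 0"
  proof (rule sum_sign_eq_0[of _ a b])
    fix p
    show "Poly_Mapping.lookup (\<Prod>i<k. x (r i) * y (c ((p \<circ> transpose a b) i))) g =
        Poly_Mapping.lookup (\<Prod>i<k. x (r i) * y (c (p i))) g"
      using prod_compose_transpose[of a "{..<k}" b "\<lambda>i. y (c (p i))"] ab
      by (simp add: prod.distrib)
  qed (use ab in auto)
  then show ?thesis by (simp add: minor_coeff_def lookup_prod_eq_hprod_coeff)
qed

text \<open>Expand each product by the set \<open>S\<close> of rows that use the first summand. By
  pigeonhole two rows lie both in \<open>S\<close> or both outside it, and exchanging them preserves
  the term, so the signed sum over permutations vanishes for each \<open>S\<close>.\<close>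

lemma minor_coeff_rank_two:
  fixes x y x' y' :: "nat \<Rightarrow> real \<Rightarrow>\<^sub>0 complex"
  assumes "3 \<le> k"
  shows "minor_coeff (\<lambda>i j. Poly_Mapping.lookup (x i * y j + x' i * y' j)) k r c g = 0"
proof -
  let ?f = "\<lambda>S p. Poly_Mapping.lookup
      ((\<Prod>i\<in>S. x (r i) * y (c (p i))) * (\<Prod>i\<in>{..<k} - S. x' (r i) * y' (c (p i)))) g"
  have zero: "(\<Sum>p | p permutes {..<k}. of_int (sign p) * ?f S p) = 0" if "S \<subseteq> {..<k}" for S
  proof -
    have "card S + card ({..<k} - S) = k"
      using that by (metis card_Diff_subset card_lessThan card_mono finite_lessThan finite_subset le_add_diff_inverse)
    then have "2 \<le> card S \<or> 2 \<le> card ({..<k} - S)" using assms by linarith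
    then obtain a b where ab: "a \<noteq> b" "a < k" "b < k" "a \<in> S \<and> b \<in> S \<or> a \<notin> S \<and> b \<notin> S"
    proof
      assume "2 \<le> card S"
      then obtain a b where "a \<in> S" "b \<in> S" "a \<noteq> b" using ex_distinct_in_set by blast
      then show ?thesis using that[of a b] \<open>S \<subseteq> {..<k}\<close> by auto
    next
      assume "2 \<le> card ({..<k} - S)"
      then obtain a b where "a \<in> {..<k} - S" "b \<in> {..<k} - S" "a \<noteq> b" using ex_distinct_in_set by blast
      then show ?thesis using that[of a b] by auto
    qed
    show ?thesis
    proof (rule sum_sign_eq_0[of _ a b])
      fix p
      have "a \<in> {..<k} - S \<and> b \<in> {..<k} - S \<or> a \<notin> {..<k} - S \<and> b \<notin> {..<k} - S"
        using ab by auto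
      from prod_compose_transpose[OF this, of "\<lambda>i. y' (c (p i))"]
        prod_compose_transpose[OF ab(4), of "\<lambda>i. y (c (p i))"]
      show "?f S (p \<circ> transpose a b) = ?f S p"
        by (simp add: prod.distrib)
    qed (use ab in auto)
  qed
  have "minor_coeff (\<lambda>i j. Poly_Mapping.lookup (x i * y j + x' i * y' j)) k r c g =
      (\<Sum>p | p permutes {..<k}. of_int (sign p) *
        Poly_Mapping.lookup (\<Prod>i<k. x (r i) * y (c (p i)) + x' (r i) * y' (c (p i))) g)"
    by (simp add: minor_coeff_def lookup_prod_eq_hprod_coeff)
  also have "\<dots> = (\<Sum>p | p permutes {..<k}. \<Sum>S\<in>Pow {..<k}. of_int (sign p) * ?f S p)"
    by (simp add: prod_add lookup_sum sum_distrib_left)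
  also have "\<dots> = (\<Sum>S\<in>Pow {..<k}. \<Sum>p | p permutes {..<k}. of_int (sign p) * ?f S p)"
    by (rule sum.swap)
  also have "\<dots> = 0" using zero by simp
  finally show ?thesis .
qed

section \<open>Lowest terms of products\<close>

lemma hdeg_leading:
  assumes "hahn f" "f \<noteq> (\<lambda>_. 0)"
  shows "f (hdeg f) \<noteq> 0" and "f x \<noteq> 0 \<Longrightarrow> hdeg f \<le> x"
proof -
  have "{x. f x \<noteq> 0} \<noteq> {}" using assms(2) by auto
  \<comment> \<open>\<open>LEAST\<close> over the reals is meaningful only if a minimum exists; the
    well-ordered support provides it.\<close>
  then obtain m where m: "f m \<noteq> 0" "\<And>x. f x \<noteq> 0 \<Longrightarrow> m \<le> x"
    using assms(1)[unfolded hahn_def, rule_format, of "{x. f x \<noteq> 0}"] by blast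
  then have "hdeg f = m" unfolding hdeg_def by (intro Least_equality) auto
  then show "f (hdeg f) \<noteq> 0" "f x \<noteq> 0 \<Longrightarrow> hdeg f \<le> x" using m by auto
qed

lemma hprod_coeff_below:
  assumes "\<And>i x. i < k \<Longrightarrow> F i x \<noteq> 0 \<Longrightarrow> d i \<le> x" "g < (\<Sum>i<k. d i)"
  shows "hprod_coeff k F g = 0"
proof -
  have "{a \<in> PiE {..<k} (\<lambda>i. {x. F i x \<noteq> 0}). (\<Sum>i<k. a i) = g} = {}"
  proof -
    have "(\<Sum>i<k. d i) \<le> (\<Sum>i<k. a i)" if "a \<in> PiE {..<k} (\<lambda>i. {x. F i x \<noteq> 0})" for a
      using that assms(1) by (intro sum_mono) (auto simp: PiE_iff)
    then show ?thesis using assms(2) by force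
  qed
  then show ?thesis unfolding hprod_coeff_def by (simp only: sum.empty)
qed

text \<open>The differences \<open>a i - d i\<close> are nonnegative and add up to 0, so a single
  tuple of exponents contributes.\<close>

lemma hprod_coeff_leading:
  assumes "\<And>i x. i < k \<Longrightarrow> F i x \<noteq> 0 \<Longrightarrow> d i \<le> x" "\<And>i. i < k \<Longrightarrow> F i (d i) \<noteq> 0"
  shows "hprod_coeff k F (\<Sum>i<k. d i) = (\<Prod>i<k. F i (d i))"
proof -
  have "{a \<in> PiE {..<k} (\<lambda>i. {x. F i x \<noteq> 0}). (\<Sum>i<k. a i) = (\<Sum>i<k. d i)} = {restrict d {..<k}}"
  proof (intro equalityI subsetI)
    fix a assume "a \<in> {a \<in> PiE {..<k} (\<lambda>i. {x. F i x \<noteq> 0}). (\<Sum>i<k. a i) = (\<Sum>i<k. d i)}"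
    then have a: "a \<in> PiE {..<k} (\<lambda>i. {x. F i x \<noteq> 0})" "(\<Sum>i<k. a i - d i) = 0"
      by (auto simp: sum_subtractf)
    have "a i - d i = 0" if "i < k" for i
      using a(2) that assms(1) a(1)
      by (subst (asm) sum_nonneg_eq_0_iff) (auto simp: PiE_iff)
    then have "a = restrict d {..<k}"
      using a(1) by (intro extensionalityI[of _ "{..<k}"]) (auto simp: PiE_def)
    then show "a \<in> {restrict d {..<k}}" by simp
  next
    fix a assume "a \<in> {restrict d {..<k}}"
    then show "a \<in> {a \<in> PiE {..<k} (\<lambda>i. {x. F i x \<noteq> 0}). (\<Sum>i<k. a i) = (\<Sum>i<k. d i)}"
      using assms(2) by auto
  qed
  then show ?thesis unfolding hprod_coeff_def by simp
qed

section \<open>Lifts of small rank\<close>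

lemma permutes_card_le_2:
  assumes "p permutes S" "finite S" "card S \<le> 2"
  shows "p = id \<or> (\<exists>a\<in>S. \<exists>b\<in>S. a \<noteq> b \<and> p = transpose a b)"
proof -
  consider "card S = 0" | "card S = 1" | "card S = 2" using assms(3) by linarith
  then show ?thesis
  proof cases
    case 1
    then show ?thesis using assms by simp
  next
    case 2
    then show ?thesis using assms(1) by (auto simp: card_1_singleton_iff)
  next
    case 3
    then obtain a b where "S = {a, b}" "a \<noteq> b" by (auto simp: card_2_iff)
    then show ?thesis using assms(1) by (auto simp: permutes_doubleton_iff)
  qed
qed

text \<open>Composing with the transposition of a moved point \<open>a\<close> and
  \<open>p a\<close> makes \<open>a\<close> fixed. What remains is an even permutation of at most
  two points, hence the identity.\<close>

lemma odd_permutes_card_le_3: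
  assumes p: "p permutes S" and "finite S" "card S \<le> 3" "sign p = -1"
  obtains a b where "a \<in> S" "b \<in> S" "a \<noteq> b" "p = transpose a b"
proof -
  have "p \<noteq> id" using assms(4) by auto
  then obtain a where a: "p a \<noteq> a" by fastforce
  let ?q = "transpose a (p a) \<circ> p"
  have aS: "a \<in> S" "p a \<in> S" using a p by (metis permutes_not_in permutes_in_image)+
  have t: "transpose a (p a) permutes S" using aS by (intro permutes_swap_id)
  have q: "?q permutes S" using p t by (rule permutes_compose)
  have "sign ?q = 1"
    using sign_compose[of "transpose a (p a)" p] p \<open>finite S\<close> assms(4) a
    by (simp add: permutes_imp_permutation permutation_swap_id sign_swap_id)
  moreover have "?q permutes (S - {a})"
    using permutes_superset[OF q, of "S - {a}"] by auto
  moreover have "card (S - {a}) \<le> 2" using assms aS by simp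
  ultimately have "?q = id"
    using permutes_card_le_2[of ?q "S - {a}"] \<open>finite S\<close>
    by (auto simp: sign_swap_id simp del: comp_apply)
  then have "transpose a (p a) \<circ> ?q = transpose a (p a)" by simp
  then have "p = transpose a (p a)" by (simp add: comp_assoc[symmetric])
  then show ?thesis using that aS a by metis
qed

text \<open>With opposite signs, \<open>p\<close> and \<open>q\<close> would differ by a
  transposition of some \<open>a\<close> and \<open>b\<close>. Cancelling the common factors leaves
  two pairs on each side, and their equality contradicts injectivity of \<open>r\<close> or
  \<open>c\<close>.\<close>

lemma sign_eq_if_sym_monomial_eq:
  fixes r c p q :: "nat \<Rightarrow> nat"
  assumes p: "p permutes {..<k}" and q: "q permutes {..<k}" and "k \<le> 3"
    and r: "inj_on r {..<k}" and c: "inj_on c {..<k}"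
    and mon: "image_mset (\<lambda>i. {r i, c (p i)}) (mset_set {..<k}) =
      image_mset (\<lambda>i. {r i, c (q i)}) (mset_set {..<k})"
  shows "sign p = sign q"
proof (rule ccontr)
  assume ne: "sign p \<noteq> sign q"
  let ?t = "inv q \<circ> p"
  have perm: "permutation p" "permutation q" using p q by (auto intro: permutes_imp_permutation)
  have t: "?t permutes {..<k}" using permutes_compose[OF p permutes_inv[OF q]] .
  have "sign ?t = sign q * sign p"
    using perm by (simp add: sign_compose sign_inverse permutation_inverse)
  also have "\<dots> = -1" using ne by (cases p rule: sign_cases; cases q rule: sign_cases) auto
  finally obtain a b where ab: "a < k" "b < k" "a \<noteq> b" "?t = transpose a b"
    using odd_permutes_card_le_3[OF t] \<open>k \<le> 3\<close> by auto
  have "p = q \<circ> ?t" using permutes_inv_o(1)[OF q] by (simp add: comp_assoc[symmetric])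
  then have pq: "p i = q (transpose a b i)" for i using ab(4) by (metis comp_apply)
  have split: "mset_set {..<k} = add_mset a (add_mset b (mset_set ({..<k} - {a, b})))"
  proof -
    have "{..<k} = insert a (insert b ({..<k} - {a, b}))" using ab by auto
    then have "mset_set {..<k} = mset_set (insert a (insert b ({..<k} - {a, b})))" by simp
    also have "\<dots> = add_mset a (add_mset b (mset_set ({..<k} - {a, b})))" using ab by simp
    finally show ?thesis .
  qed
  have rest: "image_mset (\<lambda>i. {r i, c (p i)}) (mset_set ({..<k} - {a, b})) =
      image_mset (\<lambda>i. {r i, c (q i)}) (mset_set ({..<k} - {a, b}))"
    by (intro image_mset_cong) (auto simp: pq transpose_def)
  have "{#{r a, c (q b)}, {r b, c (q a)}#} = {#{r a, c (q a)}, {r b, c (q b)}#}"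
    using mon unfolding split by (simp add: rest) (simp add: pq add_mset_commute)
  then have "{r a, c (q b)} = {r a, c (q a)} \<or> {r a, c (q b)} = {r b, c (q b)}"
    by (auto simp: add_eq_conv_ex)
  then have "c (q b) = c (q a) \<or> r a = r b" by (auto simp: doubleton_eq_iff)
  moreover have "r a \<noteq> r b" using r ab by (auto simp: inj_on_def)
  moreover have "c (q b) \<noteq> c (q a)"
  proof
    assume "c (q b) = c (q a)"
    then have "q b = q a" using c ab q permutes_in_image[OF q] by (auto simp: inj_on_def)
    then show False using permutes_inj[OF q] ab(3) by (auto dest: injD)
  qed
  ultimately show False by blast
qed

section \<open>Matchings as permutations of the row and column numbers\<close>

lemma bij_betw_image_conv_permutes:
  fixes k :: nat
  assumes r: "bij_betw r {..<k} I" and c: "bij_betw c {..<k} J" and \<rho>: "bij_betw \<rho> I J"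
  obtains p where "p permutes {..<k}" "\<And>i. i < k \<Longrightarrow> \<rho> (r i) = c (p i)"
proof -
  define f where "f = inv_into {..<k} c \<circ> (\<rho> \<circ> r)"
  \<comment> \<open>\<open>permutes\<close> demands the identity outside
    \<open>{..<k}\<close>.\<close>
  define p where "p = (\<lambda>i. if i < k then f i else i)"
  have bij: "bij_betw f {..<k} {..<k}"
    unfolding f_def using r c \<rho> by (intro bij_betw_trans bij_betw_inv_into)
  have "bij_betw p {..<k} {..<k}"
    using bij by (rule bij_betw_cong[THEN iffD1, rotated]) (auto simp: p_def)
  then have "p permutes {..<k}" by (rule bij_imp_permutes) (auto simp: p_def)
  moreover have "\<rho> (r i) = c (p i)" if "i < k" for i
  proof -
    have "\<rho> (r i) \<in> c ` {..<k}" using that r c \<rho> by (auto simp: bij_betw_def)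
    then show ?thesis using that by (simp add: p_def f_def f_inv_into_f)
  qed
  ultimately show ?thesis using that by blast
qed

lemma bij_betw_of_permutes:
  fixes k :: nat
  assumes r: "bij_betw r {..<k} I" and c: "bij_betw c {..<k} J" and p: "p permutes {..<k}"
  obtains \<rho> where "bij_betw \<rho> I J" "\<And>i. i < k \<Longrightarrow> \<rho> (r i) = c (p i)"
proof -
  define \<rho> where "\<rho> = (c \<circ> p) \<circ> inv_into {..<k} r"
  have "bij_betw \<rho> I J"
    unfolding \<rho>_def
    by (rule bij_betw_trans[OF bij_betw_inv_into[OF r] bij_betw_trans[OF permutes_imp_bij[OF p] c]])
  moreover have "\<rho> (r i) = c (p i)" if "i < k" for i
    using that r by (simp add: \<rho>_def bij_betw_def)
  ultimately show ?thesis using that by blast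
qed

lemma trop_value_reindex:
  fixes k :: nat
  assumes "bij_betw r {..<k} I" "\<And>i. i < k \<Longrightarrow> \<rho> (r i) = c (p i)"
  shows "trop_value A I \<rho> = (\<Sum>i<k. A (r i) (c (p i)))"
  unfolding trop_value_def
  using sum.reindex_bij_betw[OF assms(1), of "\<lambda>i. A i (\<rho> i)"] assms(2) by simp

lemma sym_monomial_reindex:
  fixes k :: nat
  assumes "bij_betw r {..<k} I" "\<And>i. i < k \<Longrightarrow> \<rho> (r i) = c (p i)"
  shows "sym_monomial I \<rho> = image_mset (\<lambda>i. {r i, c (p i)}) (mset_set {..<k})"
proof -
  have "mset_set I = image_mset r (mset_set {..<k})"
    using assms(1) by (simp add: bij_betw_def image_mset_mset_set)
  then show ?thesis unfolding sym_monomial_def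
    using assms(2) by (auto simp: multiset.map_comp intro!: image_mset_cong)
qed

text \<open>At the minimal value only minimal permutations contribute, each the product of its
  leading coefficients. They all have the same monomial, hence the same sign and the same product,
  so nothing cancels.\<close>

lemma nonsingular_imp_minor_nonzero:
  assumes lift: "sym_lift n A L" and "k \<le> 3"
    and r: "inj_on r {..<k}" and c: "inj_on c {..<k}" and bound: "\<forall>i<k. r i < n \<and> c i < n"
    and nonsing: "\<not> sym_trop_singular A (r ` {..<k}) (c ` {..<k})"
  shows "\<exists>g. minor_coeff L k r c g \<noteq> 0"
proof -
  let ?I = "r ` {..<k}" and ?J = "c ` {..<k}"
  have rI: "bij_betw r {..<k} ?I" and cJ: "bij_betw c {..<k} ?J"
    using r c by (auto intro: inj_on_imp_bij_betw)
  define v where "v = (\<lambda>p. \<Sum>i<k. A (r i) (c (p i)))"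
  define mon where "mon = (\<lambda>p. image_mset (\<lambda>i. {r i, c (p i)}) (mset_set {..<k}))"
  define lc where "lc = (\<lambda>i j. L i j (A i j))"
  define P where "P = (\<lambda>p. \<Prod>i<k. lc (r i) (c (p i)))"
  have L: "L i j (A i j) \<noteq> 0" "L i j x \<noteq> 0 \<Longrightarrow> A i j \<le> x" "L i j = L j i" "A i j = A j i"
    if "i < n" "j < n" for i j x
    using lift that hdeg_leading[of "L i j"] unfolding sym_lift_def by metis+
  obtain \<rho>0 where \<rho>0: "bij_betw \<rho>0 ?I ?J"
      "\<And>\<sigma>. bij_betw \<sigma> ?I ?J \<Longrightarrow> trop_value A ?I \<rho>0 \<le> trop_value A ?I \<sigma>"
    using ex_minimal_bij_betw[of ?I ?J] r c by (auto simp: card_image)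
  obtain p0 where p0: "p0 permutes {..<k}" "\<And>i. i < k \<Longrightarrow> \<rho>0 (r i) = c (p0 i)"
    using bij_betw_image_conv_permutes[OF rI cJ \<rho>0(1)] by blast
  have v0: "trop_value A ?I \<rho>0 = v p0" "sym_monomial ?I \<rho>0 = mon p0"
    using trop_value_reindex[of r k ?I \<rho>0 c p0, OF rI p0(2)]
      sym_monomial_reindex[of r k ?I \<rho>0 c p0, OF rI p0(2)] by (simp_all add: v_def mon_def)
  have min: "v p0 \<le> v p" and uniq: "v p = v p0 \<Longrightarrow> mon p = mon p0" if p: "p permutes {..<k}" for p
  proof -
    obtain \<rho> where \<rho>: "bij_betw \<rho> ?I ?J" "\<And>i. i < k \<Longrightarrow> \<rho> (r i) = c (p i)"
      using bij_betw_of_permutes[OF rI cJ p] by blast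
    have vp: "trop_value A ?I \<rho> = v p" "sym_monomial ?I \<rho> = mon p"
      using trop_value_reindex[of r k ?I \<rho> c p, OF rI \<rho>(2)]
        sym_monomial_reindex[of r k ?I \<rho> c p, OF rI \<rho>(2)] by (simp_all add: v_def mon_def)
    show "v p0 \<le> v p" using \<rho>0(2)[OF \<rho>(1)] vp v0 by simp
    show "mon p = mon p0" if "v p = v p0"
      using nonsing \<rho>0 \<rho>(1) vp v0 that unfolding sym_trop_singular_def by metis
  qed
  have bd: "r i < n" "c (p i) < n" if "i < k" "p permutes {..<k}" for i p
    using bound that permutes_in_image[of p "{..<k}" i] by auto
  have coeff: "hprod_coeff k (\<lambda>i. L (r i) (c (p i))) (v p0) = (if v p = v p0 then P p else 0)"
    if p: "p permutes {..<k}" for p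
  proof (cases "v p = v p0")
    case True
    have "hprod_coeff k (\<lambda>i. L (r i) (c (p i))) (\<Sum>i<k. A (r i) (c (p i))) = P p"
      unfolding P_def lc_def using L bd p by (intro hprod_coeff_leading) auto
    then show ?thesis using True by (simp add: v_def)
  next
    case False
    then have "v p0 < v p" using min[OF p] by simp
    then have "hprod_coeff k (\<lambda>i. L (r i) (c (p i))) (v p0) = 0"
      using L bd p unfolding v_def
      by (intro hprod_coeff_below[where d = "\<lambda>i. A (r i) (c (p i))"]) auto
    then show ?thesis using False by simp
  qed
  \<comment> \<open>By symmetry of the lift a leading coefficient depends only on the unordered
    pair; \<open>Min\<close> and \<open>Max\<close> choose an order. Thus the product is a function
    of the monomial.\<close>
  define h where "h = (\<lambda>S. lc (Min S) (Max S))"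
  have h: "h {i, j} = lc i j" if "i < n" "j < n" for i j
    using that L(3,4)[of i j] by (cases "i \<le> j") (auto simp: h_def lc_def min_def max_def)
  have P_mon: "P p = prod_mset (image_mset h (mon p))" if p: "p permutes {..<k}" for p
  proof -
    have "P p = (\<Prod>i<k. h {r i, c (p i)})"
      unfolding P_def using h bd[OF _ p] by (intro prod.cong) auto
    then show ?thesis by (simp add: prod_unfold_prod_mset mon_def multiset.map_comp comp_def)
  qed
  let ?M = "{p. p permutes {..<k} \<and> v p = v p0}"
  have fin: "finite {p. p permutes {..<k}}" by (simp add: finite_permutations)
  have "minor_coeff L k r c (v p0) =
      (\<Sum>p | p permutes {..<k}. if v p = v p0 then of_int (sign p) * P p else 0)"
    unfolding minor_coeff_def by (intro sum.cong) (auto simp: coeff)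
  also have "\<dots> = (\<Sum>p\<in>?M. of_int (sign p) * P p)"
    using sum.inter_filter[OF fin, of "\<lambda>p. of_int (sign p) * P p" "\<lambda>p. v p = v p0"] by simp
  also have "\<dots> = (\<Sum>p\<in>?M. of_int (sign p0) * P p0)"
  proof (rule sum.cong)
    fix p assume "p \<in> ?M"
    then have p: "p permutes {..<k}" and mon: "mon p = mon p0" using uniq by auto
    have "sign p = sign p0"
      using sign_eq_if_sym_monomial_eq[OF p p0(1) \<open>k \<le> 3\<close> r c] mon by (simp add: mon_def)
    then show "of_int (sign p) * P p = of_int (sign p0) * P p0"
      using P_mon[OF p] P_mon[OF p0(1)] mon by simp
  qed simp
  also have "\<dots> = of_nat (card ?M) * (of_int (sign p0) * P p0)" by simp
  \<comment> \<open>A positive multiple of a nonzero complex number.\<close>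
  also have "\<dots> \<noteq> 0"
  proof -
    have "finite ?M" using fin by (rule rev_finite_subset) auto
    moreover have "p0 \<in> ?M" using p0 by simp
    ultimately have "card ?M \<noteq> 0" by (metis card_0_eq empty_iff)
    moreover have "P p0 \<noteq> 0" unfolding P_def lc_def using L(1) bd[OF _ p0(1)] by simp
    ultimately show ?thesis by simp
  qed
  finally show ?thesis by blast
qed

lemma sym_tropical_rank_less_if_hrank_less:
  assumes "sym_lift n A L" "hrank n L < m" "0 < m" "m \<le> 3"
  shows "sym_tropical_rank n A < m"
proof -
  have "sym_trop_singular A I J" if IJ: "I \<subseteq> {..<n}" "J \<subseteq> {..<n}" "card I = m" "card J = m" for I J
  proof (rule ccontr)
    assume nonsing: "\<not> sym_trop_singular A I J"
    have "finite I" "finite J" using IJ finite_subset by blast+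
    \<comment> \<open>The minors in \<open>hrank\<close> are indexed by increasing
      enumerations.\<close>
    obtain r where r: "bij_betw r {..<m} I" "strict_mono_on {..<m} r"
      using ex_bij_betw_strict_mono_card[OF \<open>finite I\<close>] IJ(3) by auto
    obtain c where c: "bij_betw c {..<m} J" "strict_mono_on {..<m} c"
      using ex_bij_betw_strict_mono_card[OF \<open>finite J\<close>] IJ(4) by auto
    have I: "r ` {..<m} = I" "inj_on r {..<m}" and J: "c ` {..<m} = J" "inj_on c {..<m}"
      using r(1) c(1) by (auto simp: bij_betw_def)
    have bound: "\<forall>i<m. r i < n \<and> c i < n" using I(1) J(1) IJ(1,2) by auto
    have "\<exists>g. minor_coeff L m r c g \<noteq> 0"
      using nonsingular_imp_minor_nonzero[OF assms(1,4) I(2) J(2) bound] nonsing I(1) J(1) by simp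
    then show False using assms(2,3) r(2) c(2) bound by (auto simp: hrank_less_iff)
  qed
  then show ?thesis using \<open>0 < m\<close> by (simp add: sym_tropical_rank_less_iff)
qed

section \<open>Tropical rank two\<close>

text \<open>\<open>less\<close> lists the five other matchings: each is strictly worse than
  \<open>i\<close>-\<open>x\<close>, \<open>j\<close>-\<open>y\<close>,
  \<open>k\<close>-\<open>z\<close> or has the same monomial, so only one monomial is
  minimal.\<close>

lemma nonsingular_3x3:
  assumes ijk: "i \<noteq> j" "i \<noteq> k" "j \<noteq> k" and xyz: "x \<noteq> y" "x \<noteq> z" "y \<noteq> z"
    and less: "\<And>a b c. (a, b, c) \<in> {(x, z, y), (y, x, z), (y, z, x), (z, x, y), (z, y, x)} \<Longrightarrow>
      A i x + A j y + A k z < A i a + A j b + A k c \<or>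
      {#{i, a}, {j, b}, {k, c}#} = {#{i, x}, {j, y}, {k, z}#}"
  shows "\<not> sym_trop_singular A {i, j, k} {x, y, z}"
proof
  assume "sym_trop_singular A {i, j, k} {x, y, z}"
  then obtain \<sigma> \<tau> where st: "bij_betw \<sigma> {i, j, k} {x, y, z}" "bij_betw \<tau> {i, j, k} {x, y, z}"
      "sym_monomial {i, j, k} \<sigma> \<noteq> sym_monomial {i, j, k} \<tau>"
      "trop_value A {i, j, k} \<sigma> = trop_value A {i, j, k} \<tau>"
      "\<And>\<pi>. bij_betw \<pi> {i, j, k} {x, y, z} \<Longrightarrow> trop_value A {i, j, k} \<sigma> \<le> trop_value A {i, j, k} \<pi>"
    unfolding sym_trop_singular_def by blast
  have val: "trop_value A {i, j, k} \<rho> = A i (\<rho> i) + A j (\<rho> j) + A k (\<rho> k)" for \<rho>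
    using ijk by (simp add: trop_value_def)
  have mon: "sym_monomial {i, j, k} \<rho> = {#{i, \<rho> i}, {j, \<rho> j}, {k, \<rho> k}#}" for \<rho>
    using ijk by (simp add: sym_monomial_def)
  define \<pi> where "\<pi> = (\<lambda>_. z)(i := x, j := y)"
  have \<pi>: "\<pi> i = x" "\<pi> j = y" "\<pi> k = z" using ijk by (auto simp: \<pi>_def)
  then have "bij_betw \<pi> {i, j, k} {x, y, z}"
    using ijk xyz by (auto simp: bij_betw_def inj_on_def)
  then have le: "trop_value A {i, j, k} \<sigma> \<le> A i x + A j y + A k z"
    using st(5)[of \<pi>] val[of \<pi>] \<pi> by simp
  have "sym_monomial {i, j, k} \<rho> = {#{i, x}, {j, y}, {k, z}#}"
    if \<rho>: "bij_betw \<rho> {i, j, k} {x, y, z}" "trop_value A {i, j, k} \<rho> \<le> A i x + A j y + A k z" for \<rho>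
  proof -
    have "\<rho> i \<in> {x, y, z}" "\<rho> j \<in> {x, y, z}" "\<rho> k \<in> {x, y, z}"
      "\<rho> i \<noteq> \<rho> j" "\<rho> i \<noteq> \<rho> k" "\<rho> j \<noteq> \<rho> k"
      using \<rho>(1) ijk by (auto simp: bij_betw_def inj_on_def)
    then have "(\<rho> i, \<rho> j, \<rho> k) = (x, y, z) \<or>
        (\<rho> i, \<rho> j, \<rho> k) \<in> {(x, z, y), (y, x, z), (y, z, x), (z, x, y), (z, y, x)}"
      by (elim insertE emptyE) simp_all
    then show ?thesis
    proof
      assume "(\<rho> i, \<rho> j, \<rho> k) = (x, y, z)"
      then show ?thesis by (simp add: mon)
    next
      assume "(\<rho> i, \<rho> j, \<rho> k) \<in> {(x, z, y), (y, x, z), (y, z, x), (z, x, y), (z, y, x)}"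
      from less[OF this] show ?thesis using \<rho>(2) mon[of \<rho>] val[of \<rho>] by auto
    qed
  qed
  then show False using st le by metis
qed

text \<open>The entries stand for \<open>A i j - A i i / 2 - A j j / 2\<close>: this change shifts all values of a
  given submatrix by the same amount, so it preserves singularity.\<close>

locale normalized_rank_two =
  fixes n :: nat and B :: "nat \<Rightarrow> nat \<Rightarrow> real"
  assumes sym: "i < n \<Longrightarrow> j < n \<Longrightarrow> B i j = B j i"
    and diag: "i < n \<Longrightarrow> B i i = 0"
    and singular: "I \<subseteq> {..<n} \<Longrightarrow> J \<subseteq> {..<n} \<Longrightarrow> card I = 3 \<Longrightarrow> card J = 3 \<Longrightarrow>
      sym_trop_singular B I J"
begin

lemma singular_3x3:
  assumes "i < n" "j < n" "k < n" "i \<noteq> j" "i \<noteq> k" "j \<noteq> k"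
    "x < n" "y < n" "z < n" "x \<noteq> y" "x \<noteq> z" "y \<noteq> z"
  shows "sym_trop_singular B {i, j, k} {x, y, z}"
  using assms by (intro singular) auto

text \<open>The principal submatrix has the values 0, \<open>2 * a\<close>, \<open>2 * b\<close>,
  \<open>2 * c\<close> for the identity and the transpositions, and \<open>a + b + c\<close> for
  both 3-cycles, which share a monomial. None of these five may be the unique minimum; the rest is
  linear arithmetic.\<close>

lemma triple:
  assumes "i < n" "j < n" "k < n" "i \<noteq> j" "i \<noteq> k" "j \<noteq> k"
  defines "a \<equiv> B i j" and "b \<equiv> B i k" and "c \<equiv> B j k"
  shows "(a \<ge> 0 \<and> b \<ge> 0 \<and> c \<ge> 0 \<and> (a = 0 \<or> b = 0 \<or> c = 0)) \<or>
    (a < 0 \<and> b = a \<and> c \<ge> 0) \<or> (a < 0 \<and> c = a \<and> b \<ge> 0) \<or> (b < 0 \<and> c = b \<and> a \<ge> 0) \<or>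
    (a < 0 \<and> b < 0 \<and> c < 0 \<and> (a = b + c \<or> b = a + c \<or> c = a + b))"
proof -
  have sy: "B j i = a" "B k i = b" "B k j = c" "B i i = 0" "B j j = 0" "B k k = 0"
    using assms sym diag by auto
  have sing: "sym_trop_singular B {i, j, k} {x, y, z}" if "{x, y, z} = {i, j, k}" for x y z
    using singular_3x3[of i j k i j k] assms(1-6) that by metis
  note [simp] = sy a_def[symmetric] b_def[symmetric] c_def[symmetric]
  have 1: "\<not> (0 < a \<and> 0 < b \<and> 0 < c)"
    using nonsingular_3x3[of i j k i j k B] sing[of i j k] assms(4-6) by fastforce
  have 2: "\<not> (2 * a < 0 \<and> a < b \<and> a < c \<and> a < b + c)"
    using nonsingular_3x3[of i j k j i k B] sing[of j i k] assms(4-6) by fastforce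
  have 3: "\<not> (2 * b < 0 \<and> b < a \<and> b < c \<and> b < a + c)"
    using nonsingular_3x3[of i j k k j i B] sing[of k j i] assms(4-6) by fastforce
  have 4: "\<not> (2 * c < 0 \<and> c < a \<and> c < b \<and> c < a + b)"
    using nonsingular_3x3[of i j k i k j B] sing[of i k j] assms(4-6) by fastforce
  have "{#{i, k}, {j, i}, {k, j}#} = {#{i, j}, {j, k}, {k, i}#}"
    by (simp add: insert_commute add_mset_commute)
  then have 5: "\<not> (a + b + c < 0 \<and> b + c < a \<and> a + c < b \<and> a + b < c)"
    using nonsingular_3x3[of i j k j k i B] sing[of j k i] assms(4-6) by fastforce
  show ?thesis using 1 2 3 4 5 by argo
qed

text \<open>In a lift \<open>s i * s j * (p i + p j)\<close>, a negative entry records how far the valuations of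
  \<open>p i\<close> and \<open>p j\<close> are apart.\<close>

definition line_dist :: "nat \<Rightarrow> nat \<Rightarrow> real" where
  "line_dist i j = max 0 (- B i j)"

text \<open>In \<open>triple\<close>, two equal negative entries beside a nonnegative one mean two
  coinciding points, and three negative entries mean one distance is the sum of the others.\<close>

lemma line_dist_collinear:
  assumes "i < n" "j < n" "k < n"
  shows "line_dist i j = line_dist i k + line_dist j k \<or> line_dist i k = line_dist i j + line_dist j k \<or> line_dist j k = line_dist i j + line_dist i k"
proof (cases "i \<noteq> j \<and> i \<noteq> k \<and> j \<noteq> k")
  case True
  then show ?thesis using triple[of i j k] assms unfolding line_dist_def by (auto simp: max_def)
next
  case False
  then show ?thesis using sym diag assms unfolding line_dist_def by (auto simp: max_def)
qed

text \<open>Excludes the pseudo-linear quadruples, the only obstruction to realising on a line a metric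
  whose triples are all collinear.\<close>

lemma no_pseudo_linear:
  assumes "p < n" "q < n" "s < n" "t < n" "0 < \<alpha>" "0 < \<beta>"
    "line_dist p q = \<alpha>" "line_dist s t = \<alpha>" "line_dist q s = \<beta>" "line_dist p t = \<beta>" "line_dist p s = \<alpha> + \<beta>" "line_dist q t = \<alpha> + \<beta>"
  shows False
proof -
  have B_eq: "B i j = - line_dist i j" if "0 < line_dist i j" for i j
    using that by (simp add: line_dist_def max_def split: if_splits)
  have B: "B p q = - \<alpha>" "B s t = - \<alpha>" "B q s = - \<beta>" "B p t = - \<beta>" "B p s = - \<alpha> - \<beta>" "B q t = - \<alpha> - \<beta>"
    using assms B_eq[of p q] B_eq[of s t] B_eq[of q s] B_eq[of p t] B_eq[of p s] B_eq[of q t]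
    by linarith+
  moreover have "B q p = - \<alpha>" "B s q = - \<beta>" "B s p = - \<alpha> - \<beta>"
    using B sym assms(1-4) by metis+
  moreover have ne: "p \<noteq> q" "p \<noteq> s" "p \<noteq> t" "q \<noteq> s" "q \<noteq> t" "s \<noteq> t"
    using B assms(5,6) diag[OF assms(1)] diag[OF assms(2)] diag[OF assms(3)] by auto
  \<comment> \<open>The matching \<open>p\<close>-\<open>q\<close>,
    \<open>q\<close>-\<open>t\<close>, \<open>s\<close>-\<open>p\<close> has value
    \<open>- 3 * \<alpha> - 2 * \<beta>\<close>, strictly below all others.\<close>
  ultimately have "\<not> sym_trop_singular B {p, q, s} {q, t, p}"
    using assms(1-6) diag by (intro nonsingular_3x3) auto
  then show False using singular_3x3[of p q s q t p] assms(1-4) ne by auto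
qed

text \<open>Choose \<open>p\<close> and \<open>q\<close> at maximal distance and use the distance
  from \<open>p\<close> as coordinate. All points lie between \<open>p\<close> and \<open>q\<close>;
  a pair \<open>i\<close>, \<open>j\<close> with the wrong distance would make \<open>p\<close>,
  \<open>i\<close>, \<open>q\<close>, \<open>j\<close> pseudo-linear.\<close>

lemma line_embedding:
  obtains v :: "nat \<Rightarrow> real" where "\<And>i j. i < n \<Longrightarrow> j < n \<Longrightarrow> line_dist i j = \<bar>v i - v j\<bar>"
proof (cases "n = 0")
  case True
  then show ?thesis using that by simp
next
  case False
  have dsym: "line_dist i j = line_dist j i" if "i < n" "j < n" for i j
    using sym[OF that] by (simp add: line_dist_def)
  have nonneg: "0 \<le> line_dist i j" for i j by (simp add: line_dist_def)
  let ?D = "(\<lambda>(i, j). line_dist i j) ` ({..<n} \<times> {..<n})"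
  have "finite ?D" "?D \<noteq> {}" using False by auto
  then have "Max ?D \<in> ?D" by (rule Max_in)
  then obtain p q where pq: "p < n" "q < n" "Max ?D = line_dist p q" by auto
  have max: "line_dist i j \<le> line_dist p q" if "i < n" "j < n" for i j
    unfolding pq(3)[symmetric] using that \<open>finite ?D\<close> by (intro Max_ge) auto
  have "line_dist i j = \<bar>line_dist p i - line_dist p j\<bar>" if ij: "i < n" "j < n" for i j
  proof (rule ccontr)
    assume ne: "line_dist i j \<noteq> \<bar>line_dist p i - line_dist p j\<bar>"
    have between: "line_dist p x + line_dist q x = line_dist p q" if "x < n" for x
      using line_dist_collinear[OF pq(1,2) that] max[OF pq(1) that] max[OF pq(2) that] nonneg[of p x] nonneg[of q x]
      by linarith
    \<comment> \<open>The two other collinear positions of \<open>i\<close>, \<open>j\<close>,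
      \<open>p\<close> would give the distance excluded by \<open>ne\<close>.\<close>
    have 1: "line_dist i j = line_dist p i + line_dist p j"
      using line_dist_collinear[OF ij pq(1)] ne nonneg[of i j] dsym[OF ij(1) pq(1)] dsym[OF ij(2) pq(1)] by linarith
    have 2: "line_dist i j = line_dist q i + line_dist q j"
      using line_dist_collinear[OF ij pq(2)] ne nonneg[of i j] dsym[OF ij(1) pq(2)] dsym[OF ij(2) pq(2)] between[OF ij(1)] between[OF ij(2)]
      by linarith
    have "0 < line_dist p i" "0 < line_dist p j"
      using 1 ne nonneg[of p i] nonneg[of p j] by linarith+
    then show False
      using no_pseudo_linear[of p i q j "line_dist p i" "line_dist p j"] 1 2 pq ij between[OF ij(1)] between[OF ij(2)] dsym[OF ij(1) pq(2)]
      by linarith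
  qed
  then show ?thesis using that by blast
qed

section \<open>The graph of entries above a level\<close>

lemma no_triangle:
  assumes "i < n" "j < n" "k < n" "0 < B i j" "0 < B j k"
  shows "B i k = 0"
proof (cases "i = k")
  case False
  moreover have "i \<noteq> j" "j \<noteq> k" using assms(4,5) diag[OF assms(2)] by auto
  \<comment> \<open>With two positive entries only the first alternative of \<open>triple\<close>
    survives, and its vanishing entry must be the third.\<close>
  ultimately show ?thesis using triple[of i j k] assms by auto
qed (use assms diag in auto)

text \<open>If \<open>B i l \<le> r\<close>, then in rows \<open>i\<close>, \<open>j\<close>,
  \<open>k\<close> and columns \<open>l\<close>, \<open>j\<close>, \<open>k\<close> the matching
  \<open>i\<close>-\<open>l\<close>, \<open>j\<close>-\<open>j\<close>,
  \<open>k\<close>-\<open>k\<close> has value \<open>B i l\<close>. Every other matching uses an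
  edge of the path and is strictly larger, contradicting singularity.\<close>

lemma path_closure:
  assumes ijkl: "i < n" "j < n" "k < n" "l < n" and "0 \<le> r" and gr: "r < B i j" "r < B j k" "r < B k l"
  shows "r < B i l"
proof (rule ccontr)
  assume le: "\<not> r < B i l"
  have ik: "B i k = 0" and jl: "B j l = 0" using no_triangle[of i j k] no_triangle[of j k l] assms by auto
  have ne: "i \<noteq> j" "j \<noteq> k" "k \<noteq> l"
    using gr \<open>0 \<le> r\<close> diag[OF ijkl(2)] diag[OF ijkl(3)] by auto
  have ne': "i \<noteq> k" "j \<noteq> l" "i \<noteq> l" using le gr ik \<open>0 \<le> r\<close> sym[OF ijkl(1) ijkl(3)] by auto
  have "0 \<le> B i l" using triple[of i j l] ijkl ne ne' jl gr(1) \<open>0 \<le> r\<close> by auto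
  moreover have "B k j = B j k" using sym ijkl by auto
  ultimately have "\<not> sym_trop_singular B {i, j, k} {l, j, k}"
    using ne ne' gr le \<open>0 \<le> r\<close> diag ijkl ik jl by (intro nonsingular_3x3) auto
  then show False using singular_3x3[of i j k l j k] ijkl ne ne' by auto
qed

end

section \<open>Construction of lifts\<close>

lemma hahn_lookup: "hahn (Poly_Mapping.lookup p)"
  unfolding hahn_def
proof (intro allI impI)
  fix S assume S: "S \<subseteq> {x. Poly_Mapping.lookup p x \<noteq> 0}" "S \<noteq> {}"
  then have "finite S" by (metis finite_lookup finite_subset)
  then show "\<exists>m\<in>S. \<forall>x\<in>S. m \<le> x" using S(2) Min_in Min_le by metis
qed

lemma hdeg_eqI:
  assumes "f x \<noteq> 0" "\<And>y. y < x \<Longrightarrow> f y = 0"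
  shows "hdeg f = x"
  unfolding hdeg_def using assms by (metis (mono_tags, lifting) Least_equality not_le)

lemma sym_lift_lookupI:
  assumes "\<And>i j. i < n \<Longrightarrow> j < n \<Longrightarrow> M i j = M j i"
    and "\<And>i j. i < n \<Longrightarrow> j < n \<Longrightarrow> Poly_Mapping.lookup (M i j) (A i j) \<noteq> 0"
    and "\<And>i j x. i < n \<Longrightarrow> j < n \<Longrightarrow> x < A i j \<Longrightarrow> Poly_Mapping.lookup (M i j) x = 0"
  shows "sym_lift n A (\<lambda>i j. Poly_Mapping.lookup (M i j))"
  unfolding sym_lift_def
proof (intro allI impI conjI)
  fix i j assume ij: "i < n" "j < n"
  show "Poly_Mapping.lookup (M i j) \<noteq> (\<lambda>_. 0)" using assms(2)[OF ij] by metis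
  show "hdeg (Poly_Mapping.lookup (M i j)) = A i j" using assms(2,3)[OF ij] by (rule hdeg_eqI)
  show "Poly_Mapping.lookup (M i j) = Poly_Mapping.lookup (M j i)" using assms(1)[OF ij] by simp
qed (rule hahn_lookup)

context normalized_rank_two
begin

text \<open>By \<open>path_closure\<close> the entries exceeding a level \<open>r \<ge> 0\<close> form a disjoint union of
  complete bipartite graphs; \<open>cls r i\<close> is the component of \<open>i\<close>.\<close>

definition cls :: "real \<Rightarrow> nat \<Rightarrow> nat set" where
  "cls r i = {j. j < n \<and> (j = i \<or> r < B i j \<or> (\<exists>k<n. r < B i k \<and> r < B k j))}"

definition rep :: "real \<Rightarrow> nat \<Rightarrow> nat" where
  "rep r i = Min (cls r i)"

text \<open>The side of the level 0 component opposite to its representative gets -1. This serves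
  all levels \<open>r \<ge> 0\<close>, because an entry above \<open>r\<close> is positive.\<close>

definition side :: "nat \<Rightarrow> complex" where
  "side i = (if 0 < B i (rep 0 i) then -1 else 1)"

text \<open>\<open>Suc\<close> keeps the label nonzero when the representative is vertex 0.\<close>

definition coef :: "real \<Rightarrow> nat \<Rightarrow> complex" where
  "coef r i = side i * of_nat (Suc (rep r i))"

lemma cls_sym:
  assumes "i < n" "j \<in> cls r i"
  shows "i \<in> cls r j"
proof -
  have j: "j < n" and "j = i \<or> r < B i j \<or> (\<exists>k<n. r < B i k \<and> r < B k j)"
    using assms(2) by (auto simp: cls_def)
  then consider "j = i" | "r < B j i" | k where "k < n" "r < B k i" "r < B j k"
    using sym[OF assms(1)] sym[OF _ j] by metis
  then show ?thesis by cases (use assms(1) in \<open>auto simp: cls_def\<close>)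
qed

text \<open>Concatenation gives at most four edges, and \<open>path_closure\<close> replaces three
  consecutive edges by one.\<close>

lemma cls_trans:
  assumes "0 \<le> r" "i < n" and j: "j \<in> cls r i" and k: "k \<in> cls r j"
  shows "k \<in> cls r i"
proof -
  have jk: "j < n" "k < n" using j k by (auto simp: cls_def)
  note path = path_closure[OF _ _ _ _ \<open>0 \<le> r\<close>]
  consider "j = i" | "r < B i j" | l where "l < n" "r < B i l" "r < B l j"
    using j by (auto simp: cls_def)
  then show ?thesis
  proof cases
    case 1
    then show ?thesis using k by simp
  next
    case 2
    then show ?thesis using k jk path[of i j _ k] \<open>i < n\<close> by (auto simp: cls_def)
  next
    case (3 l)
    consider "k = j" | "r < B j k" | m where "m < n" "r < B j m" "r < B m k"
      using k by (auto simp: cls_def)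
    then show ?thesis
    proof cases
      case 1
      then show ?thesis using j by simp
    next
      case 2
      then show ?thesis using path[of i l j k] 3 jk \<open>i < n\<close> by (auto simp: cls_def)
    next
      case (3 m)
      then have "r < B i m" using path[of i l j m] \<open>l < n\<close> \<open>r < B i l\<close> \<open>r < B l j\<close> jk \<open>i < n\<close> by auto
      then show ?thesis using 3 jk by (auto simp: cls_def)
    qed
  qed
qed

lemma cls_eq:
  assumes "0 \<le> r" "i < n" "j \<in> cls r i"
  shows "cls r j = cls r i"
proof -
  have "j < n" using assms(3) by (simp add: cls_def)
  then show ?thesis using cls_trans[OF assms(1)] cls_sym assms by blast
qed

lemma rep_in_cls:
  assumes "i < n"
  shows "rep r i \<in> cls r i"
proof -
  have "finite (cls r i)" by (simp add: cls_def)
  moreover have "i \<in> cls r i" using assms by (simp add: cls_def)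
  ultimately show ?thesis unfolding rep_def by (intro Min_in) auto
qed

lemma rep_eq_iff:
  assumes "0 \<le> r" "i < n" "j < n"
  shows "rep r i = rep r j \<longleftrightarrow> j \<in> cls r i"
proof
  assume "rep r i = rep r j"
  then have "cls r i = cls r j" using cls_eq rep_in_cls assms by metis
  then show "j \<in> cls r i" using assms by (simp add: cls_def)
next
  assume "j \<in> cls r i"
  then show "rep r i = rep r j" using cls_eq[OF assms(1,2)] by (simp add: rep_def)
qed

text \<open>The common representative \<open>m\<close> is adjacent to exactly one of
  \<open>i\<close> and \<open>j\<close>: not to both by \<open>no_triangle\<close>, and to at least
  one by \<open>path_closure\<close>.\<close>

lemma side_opposite:
  assumes ij: "i < n" "j < n" and gr: "0 < B i j"
  shows "side i = - side j"
proof -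
  define m where "m = rep 0 i"
  have m: "m \<in> cls 0 i" "m < n" using rep_in_cls[OF ij(1), of 0] by (auto simp: m_def cls_def)
  have "j \<in> cls 0 i" using ij gr by (simp add: cls_def)
  then have mj: "rep 0 j = m" using rep_eq_iff[of 0 i j] ij by (simp add: m_def)
  have ji: "0 < B j i" using gr sym[OF ij] by simp
  have "\<not> (0 < B i m \<and> 0 < B j m)"
    using no_triangle[of i m j] ij m(2) gr sym[of j m] by auto
  moreover have "0 < B i m \<or> 0 < B j m"
    using m path_closure[of j i _ m 0] ij ji unfolding cls_def by auto
  ultimately show ?thesis by (auto simp: side_def m_def[symmetric] mj)
qed

lemma coef_cancel:
  assumes "i < n" "j < n" "0 \<le> r" "r < B i j"
  shows "coef r i + coef r j = 0"
proof -
  have "j \<in> cls r i" using assms by (simp add: cls_def)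
  then have "rep r i = rep r j" using rep_eq_iff assms by blast
  moreover have "side i = - side j" using side_opposite assms by simp
  ultimately show ?thesis by (simp add: coef_def)
qed

lemma side_cases: "side i = 1 \<or> side i = -1"
  by (simp add: side_def)

lemma coef_nonzero: "coef r i \<noteq> 0"
  using side_cases[of i] by (auto simp: coef_def simp del: of_nat_Suc)

text \<open>Cancellation would need opposite signs and equal labels. At level \<open>B i j\<close>
  itself, \<open>i\<close> and \<open>j\<close> are not adjacent, so in a common component they are
  equal or have a common neighbour; either way their signs agree.\<close>

lemma coef_sum_nonzero:
  assumes ij: "i < n" "j < n" and "0 \<le> B i j"
  shows "coef (B i j) i + coef (B i j) j \<noteq> 0"
proof
  let ?r = "B i j"
  assume zero: "coef ?r i + coef ?r j = 0"
  have opp: "side i \<noteq> side j"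
  proof
    assume eq: "side i = side j"
    have "coef ?r i + coef ?r j = side j * of_nat (Suc (rep ?r i) + Suc (rep ?r j))"
      unfolding coef_def eq of_nat_add distrib_left ..
    moreover have "of_nat (Suc (rep ?r i) + Suc (rep ?r j)) \<noteq> (0 :: complex)"
      unfolding of_nat_eq_0_iff by simp
    ultimately show False using zero side_cases[of j] by (metis mult_eq_0_iff neg_equal_0_iff_equal zero_neq_one)
  qed
  have "rep ?r i = rep ?r j"
    using zero opp side_cases[of i] side_cases[of j] by (auto simp: coef_def simp del: of_nat_Suc)
  then have "j \<in> cls ?r i" using rep_eq_iff assms by blast
  then consider "j = i" | k where "k < n" "?r < B i k" "?r < B k j" by (auto simp: cls_def)
  then show False
  proof cases
    case 1
    then show ?thesis using opp by simp
  next
    case 2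
    then have "side i = - side k" "side k = - side j"
      using side_opposite[of i k] side_opposite[of k j] assms by auto
    then show ?thesis using opp by simp
  qed
qed

text \<open>The factors are \<open>x i = s i\<close> and \<open>y i = s i * p i\<close>, where \<open>s i = t^(a i - v i)\<close> and
  \<open>p i = t^(2 * v i) * (\<Sum>r. coef r i * t^r)\<close>.\<close>

lemma ex_rank_two_factors:
  fixes a :: "nat \<Rightarrow> real"
  shows "\<exists>x y :: nat \<Rightarrow> real \<Rightarrow>\<^sub>0 complex. sym_lift n (\<lambda>i j. B i j + a i + a j)
    (\<lambda>i j. Poly_Mapping.lookup (x i * y j + y i * x j))"
proof -
  obtain v where v: "\<And>i j. i < n \<Longrightarrow> j < n \<Longrightarrow> line_dist i j = \<bar>v i - v j\<bar>"
    using line_embedding by blast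
  \<comment> \<open>Finitely many exponents suffice: nonnegative entries need a surviving
    coefficient at their own level, and negative entries use the one at 0.\<close>
  define R where "R = insert 0 {r \<in> (\<lambda>(i, j). B i j) ` ({..<n} \<times> {..<n}). 0 \<le> r}"
  have "finite R" by (simp add: R_def)
  have R0: "0 \<le> r" if "r \<in> R" for r using that by (auto simp: R_def)
  define C where "C = (\<lambda>s i. if s \<in> R then coef s i else 0)"
  define x :: "nat \<Rightarrow> real \<Rightarrow>\<^sub>0 complex" where "x = (\<lambda>i. Poly_Mapping.single (a i - v i) 1)"
  define y where "y = (\<lambda>i. \<Sum>r\<in>R. Poly_Mapping.single (a i + v i + r) (coef r i))"
  \<comment> \<open>Exponents are measured relative to \<open>a i + a j\<close>.\<close>
  have lookup_xy: "Poly_Mapping.lookup (x i * y j) (s + a i + a j) = C (s + v i - v j) j" for i j s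
  proof -
    have "x i * y j = (\<Sum>r\<in>R. Poly_Mapping.single (a i - v i + (a j + v j + r)) (coef r j))"
      by (simp add: x_def y_def sum_distrib_left mult_single)
    then have "Poly_Mapping.lookup (x i * y j) (s + a i + a j) =
        (\<Sum>r\<in>R. if r = s + v i - v j then coef r j else 0)"
      by (auto simp: lookup_sum lookup_single when_def intro!: sum.cong)
    then show ?thesis using \<open>finite R\<close> by (simp add: C_def)
  qed
  have lookup: "Poly_Mapping.lookup (x i * y j + y i * x j) (s + a i + a j) =
      C (s + v i - v j) j + C (s + v j - v i) i" for i j s
    using lookup_xy[of i j s] lookup_xy[of j i s]
    by (simp add: lookup_add mult.commute[of "y i"] ac_simps)
  have C_neg: "C s i = 0" if "s < 0" for s i using that R0 by (force simp: C_def)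
  have entry: "C (B i j + v i - v j) j + C (B i j + v j - v i) i \<noteq> 0"
      "s < B i j \<Longrightarrow> C (s + v i - v j) j + C (s + v j - v i) i = 0"
    if ij: "i < n" "j < n" for i j s
  proof -
    have B: "max 0 (- B i j) = \<bar>v i - v j\<bar>" using v[OF ij] by (simp add: line_dist_def)
    have C0: "C 0 i \<noteq> 0" for i using coef_nonzero by (simp add: C_def R_def)
    show "C (B i j + v i - v j) j + C (B i j + v j - v i) i \<noteq> 0"
    proof (cases "v i = v j")
      case True
      then have "0 \<le> B i j" using B by linarith
      then have "B i j \<in> R" using ij by (auto simp: R_def)
      then show ?thesis
        using True coef_sum_nonzero[OF ij \<open>0 \<le> B i j\<close>] by (simp add: C_def add.commute)
    next
      case False
      \<comment> \<open>The valuations differ, so at the lowest exponent only the series with the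
        smaller one contributes.\<close>
      then consider "v i < v j" "B i j = v i - v j" | "v j < v i" "B i j = v j - v i"
        using B by linarith
      then show ?thesis using C0 C_neg by cases auto
    qed
    show "C (s + v i - v j) j + C (s + v j - v i) i = 0" if "s < B i j"
    proof (cases "v i = v j")
      case True
      then show ?thesis
        using coef_cancel[OF ij _ \<open>s < B i j\<close>] R0[of s] by (auto simp: C_def add.commute)
    next
      case False
      then have "s + v i - v j < 0" "s + v j - v i < 0" using B \<open>s < B i j\<close> by linarith+
      then show ?thesis using C_neg by simp
    qed
  qed
  have "sym_lift n (\<lambda>i j. B i j + a i + a j) (\<lambda>i j. Poly_Mapping.lookup (x i * y j + y i * x j))"
  proof (rule sym_lift_lookupI)
    show "Poly_Mapping.lookup (x i * y j + y i * x j) (B i j + a i + a j) \<noteq> 0"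
      if "i < n" "j < n" for i j
      using lookup[of i j "B i j"] entry(1)[OF that] by simp
    show "Poly_Mapping.lookup (x i * y j + y i * x j) s = 0"
      if "i < n" "j < n" "s < B i j + a i + a j" for i j s
      using lookup[of i j "s - a i - a j"] entry(2)[OF that(1,2), of "s - a i - a j"] that(3) by simp
  qed (simp add: ac_simps)
  then show ?thesis by blast
qed

end

section \<open>Comparison of the two ranks\<close>

lemma ex_lift_hrank_less_3:
  assumes sym: "\<forall>i<n. \<forall>j<n. A i j = A j i" and rank: "sym_tropical_rank n A < 3"
  shows "\<exists>L. sym_lift n A L \<and> hrank n L < 3"
proof -
  define a where "a = (\<lambda>i. A i i / 2)"
  define B where "B = (\<lambda>i j. A i j - a i - a j)"
  have A: "A = (\<lambda>i j. B i j + a i + a j)" by (simp add: B_def)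
  interpret normalized_rank_two n B
  proof
    fix I J assume "I \<subseteq> {..<n}" "J \<subseteq> {..<n}" "card I = 3" "card J = 3"
    then have "sym_trop_singular A I J" using rank by (simp add: sym_tropical_rank_less_iff)
    then show "sym_trop_singular B I J" using sym_trop_singular_shift[of B a I J] by (simp add: A)
  qed (use sym in \<open>auto simp: B_def a_def\<close>)
  obtain x y :: "nat \<Rightarrow> real \<Rightarrow>\<^sub>0 complex"
    where "sym_lift n A (\<lambda>i j. Poly_Mapping.lookup (x i * y j + y i * x j))"
    using ex_rank_two_factors[of a] A by auto
  moreover have "hrank n (\<lambda>i j. Poly_Mapping.lookup (x i * y j + y i * x j)) < 3"
    by (simp add: hrank_less_iff minor_coeff_rank_two)
  ultimately show ?thesis by blast
qed

text \<open>Singularity of the principal 2 by 2 submatrices already forces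
  \<open>A i j = a i + a j\<close>, and the products of the monomials \<open>t^(a i)\<close> and
  \<open>t^(a j)\<close> lift this.\<close>

lemma ex_lift_hrank_less_2:
  assumes sym: "\<forall>i<n. \<forall>j<n. A i j = A j i" and rank: "sym_tropical_rank n A < 2"
  shows "\<exists>L. sym_lift n A L \<and> hrank n L < 2"
proof -
  define a where "a = (\<lambda>i. A i i / 2)"
  have A: "A i j = a i + a j" if ij: "i < n" "j < n" for i j
  proof (cases "i = j")
    case False
    have "sym_trop_singular A {i, j} {i, j}"
      using rank ij False by (simp add: sym_tropical_rank_less_iff)
    then obtain \<sigma> \<tau> where st: "bij_betw \<sigma> {i, j} {i, j}" "bij_betw \<tau> {i, j} {i, j}"
        "sym_monomial {i, j} \<sigma> \<noteq> sym_monomial {i, j} \<tau>"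
        "trop_value A {i, j} \<sigma> = trop_value A {i, j} \<tau>"
      unfolding sym_trop_singular_def by blast
    have two: "\<rho> i = i \<and> \<rho> j = j \<or> \<rho> i = j \<and> \<rho> j = i" if "bij_betw \<rho> {i, j} {i, j}" for \<rho>
      using that False by (auto simp: bij_betw_def)
    have "A i i + A j j = A i j + A j i"
      using two[OF st(1)] two[OF st(2)] st(3,4) False by (auto simp: sym_monomial_def trop_value_def)
    then show ?thesis using sym ij by (simp add: a_def)
  qed (simp add: a_def)
  define x :: "nat \<Rightarrow> real \<Rightarrow>\<^sub>0 complex" where "x = (\<lambda>i. Poly_Mapping.single (a i) 1)"
  have "sym_lift n A (\<lambda>i j. Poly_Mapping.lookup (x i * x j))"
    by (rule sym_lift_lookupI) (auto simp: A x_def mult_single lookup_single when_def add.commute)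
  moreover have "hrank n (\<lambda>i j. Poly_Mapping.lookup (x i * x j)) < 2"
    by (simp add: hrank_less_iff minor_coeff_rank_one)
  ultimately show ?thesis by blast
qed

lemma sym_kapranov_rank_less_iff:
  assumes "\<forall>i<n. \<forall>j<n. A i j = A j i"
  shows "sym_kapranov_rank n A < m \<longleftrightarrow> (\<exists>L. sym_lift n A L \<and> hrank n L < m)"
proof -
  \<comment> \<open>The monomials \<open>t^(A i j)\<close> form a lift, so the \<open>LEAST\<close>
    in the Kapranov rank is attained.\<close>
  have "sym_lift n A (\<lambda>i j. Poly_Mapping.lookup (Poly_Mapping.single (A i j) 1))"
    using assms by (intro sym_lift_lookupI) (auto simp: lookup_single when_def)
  then have "\<exists>k L. sym_lift n A L \<and> hrank n L = k" by blast
  then have "\<exists>L. sym_lift n A L \<and> hrank n L = sym_kapranov_rank n A"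
    unfolding sym_kapranov_rank_def by (rule LeastI_ex)
  moreover have "sym_kapranov_rank n A \<le> hrank n L" if "sym_lift n A L" for L
    unfolding sym_kapranov_rank_def using that by (intro Least_le) blast
  ultimately show ?thesis by (metis le_less_trans)
qed

theorem theorem6:
  fixes n :: nat and A :: "nat \<Rightarrow> nat \<Rightarrow> real"
  assumes "\<forall>i<n. \<forall>j<n. A i j = A j i"
  shows "sym_kapranov_rank n A = 2 \<longleftrightarrow> sym_tropical_rank n A = 2"
proof -
  \<comment> \<open>Rank two means rank below 3 but not below 2, so two comparisons suffice.\<close>
  have "sym_kapranov_rank n A < 2 \<longleftrightarrow> sym_tropical_rank n A < 2"
    using sym_kapranov_rank_less_iff[OF assms] sym_tropical_rank_less_if_hrank_less
      ex_lift_hrank_less_2[OF assms] by fastforce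
  moreover have "sym_kapranov_rank n A < 3 \<longleftrightarrow> sym_tropical_rank n A < 3"
    using sym_kapranov_rank_less_iff[OF assms] sym_tropical_rank_less_if_hrank_less
      ex_lift_hrank_less_3[OF assms] by fastforce
  ultimately show ?thesis by linarith
qed

end
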